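(* Let $d, M \geq 1$ be integers, let $\beta \in (0,1)$, and let $\bm{y}$ be an $\mathbb{R}^d$-valued random variable distributed as a Gaussian mixture with $M$ components, with weights $\alpha_1,\dots,\alpha_M > 0$, $\sum_{j=1}^M \alpha_j = 1$, means $\bar{\bm{\mu}}_1,\dots,\bar{\bm{\mu}}_M \in \mathbb{R}^d$ and symmetric positive definite covariance matrices $\bm{S}_1,\dots,\bm{S}_M \in \mathbb{R}^{d\times d}$. For each $j \in \{1,\dots,M\}$ let $\bm{y}_j \sim \mathcal{N}(\bar{\bm{\mu}}_j, \bm{S}_j)$, let $\beta_{\mathrm{R},j} = 1 - \mathbb{P}(\bm{y}_j \preceq \bm{0})$, and let $\beta_{\mathrm{T},j}$ be a real number with $\beta_{\mathrm{T},j} \geq \beta_{\mathrm{R},j}$ (a conservative estimate of the failure risk of the $j$-th component). Let $\beta_{\mathrm{R}} = 1 - \mathbb{P}(\bm{y} \preceq \bm{0})$. Define $\beta^*_1,\dots,\beta^*_M$ and $\delta_1,\dots,\delta_M$ recursively by $$\beta^*_1 = \beta, \qquad \delta_j = \beta^*_j - \beta_{\mathrm{T},j} \quad (1 \leq j \leq M), \qquad \beta^*_{j+1} = \beta + \frac{\alpha_j}{\alpha_{j+1}}\,\delta_j \quad (1 \leq j \leq M-1).$$ If $\beta_{\mathrm{T},j} \leq \beta^*_j$ for all $j \in \{1,\dots,M\}$, then $\beta_{\mathrm{R}} \leq \beta$.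
   Context: For vectors $\bm{a}, \bm{b} \in \mathbb{R}^d$, $\bm{a} \preceq \bm{b}$ means that every component of $\bm{a}$ is less than or equal to the corresponding component of $\bm{b}$. A random variable $\bm{y}$ is distributed as a Gaussian mixture with weights $\alpha_j$, means $\bar{\bm{\mu}}_j$ and covariances $\bm{S}_j$ if its probability density function is $\sum_{j=1}^{M} \alpha_j\, p_{\mathrm{G}}(\cdot\,; \bar{\bm{\mu}}_j, \bm{S}_j)$, where $p_{\mathrm{G}}(\cdot\,;\bar{\bm{\mu}},\bm{S})$ is the density of the multivariate normal distribution $\mathcal{N}(\bar{\bm{\mu}}, \bm{S})$. The failure risk of a random vector $\bm{z}$ is $1 - \mathbb{P}(\bm{z} \preceq \bm{0})$; $\beta$ is the target (acceptable) failure risk. *)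

theory Defs
  imports "HOL-Probability.Probability"
begin

definition sym_pos_def :: "real ^ 'd ^ 'd \<Rightarrow> bool" where
  "sym_pos_def S \<longleftrightarrow> transpose S = S \<and> (\<forall>x. x \<noteq> 0 \<longrightarrow> x \<bullet> (S *v x) > 0)"

definition gaussian_density :: "real ^ 'd \<Rightarrow> real ^ 'd ^ 'd \<Rightarrow> real ^ 'd \<Rightarrow> real" where
  "gaussian_density \<mu> S x =
     exp (- ((x - \<mu>) \<bullet> (matrix_inv S *v (x - \<mu>))) / 2) / sqrt ((2 * pi) ^ CARD('d) * det S)"

(* Only meant for symmetric positive definite S, where the normal law is the one
   with this Lebesgue density. *)
definition gaussian_distributed ::
    "'a measure \<Rightarrow> ('a \<Rightarrow> real ^ 'd) \<Rightarrow> real ^ 'd \<Rightarrow> real ^ 'd ^ 'd \<Rightarrow> bool" where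
  "gaussian_distributed P y \<mu> S \<longleftrightarrow>
     distributed P lborel y (\<lambda>x. ennreal (gaussian_density \<mu> S x))"

definition gaussian_mixture_distributed ::
    "'a measure \<Rightarrow> ('a \<Rightarrow> real ^ 'd) \<Rightarrow> nat \<Rightarrow> (nat \<Rightarrow> real) \<Rightarrow> (nat \<Rightarrow> real ^ 'd) \<Rightarrow>
       (nat \<Rightarrow> real ^ 'd ^ 'd) \<Rightarrow> bool" where
  "gaussian_mixture_distributed P y M \<alpha> \<mu> S \<longleftrightarrow>
     distributed P lborel y (\<lambda>x. ennreal (\<Sum>j = 1..M. \<alpha> j * gaussian_density (\<mu> j) (S j) x))"

(* The library order on real ^ 'd is the componentwise one (less_eq_vec_def). *)
definition failure_risk :: "'a measure \<Rightarrow> ('a \<Rightarrow> real ^ 'd) \<Rightarrow> real" where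
  "failure_risk P z = 1 - measure P {\<omega> \<in> space P. z \<omega> \<le> 0}"

end

theory Submission
  imports Defs
begin

text \<open>
  The probability of no failure is the integral of the density over the orthant \<open>{..0}\<close>.
  Integration is linear in the density, hence the failure risk of the
  mixture is the \<open>\<alpha>\<close>-weighted average of the failure risks of the components
  (\<open>mixture_failure_risk\<close>). It remains to see that the \<open>\<alpha>\<close>-weighted average of the bounds
  \<open>\<beta>T j\<close> is at most \<open>\<beta>\<close>. The recursion merely hands the unspent part of each component's
  allowance on to the next component: multiplied by \<open>\<alpha> (j + 1)\<close>, it says that
  \<open>\<alpha> j * \<delta> j\<close> is the accumulated surplus of the components up to \<open>j\<close>
  (\<open>weighted_slack_eq_accumulated_surplus\<close>). The surplus of all \<open>M\<close> components is therefore
  \<open>\<alpha> M * \<delta> M\<close>, which is nonnegative because \<open>\<beta>T M \<le> \<beta>star M\<close>.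
\<close>

lemma mixture_emeasure:
  assumes y: "distributed P N y (\<lambda>x. \<Sum>j\<in>J. w j * f j x)"
    and yc: "\<And>j. j \<in> J \<Longrightarrow> distributed (Q j) N (yc j) (f j)"
    and A: "A \<in> sets N"
  shows "emeasure P (y -` A \<inter> space P)
    = (\<Sum>j\<in>J. w j * emeasure (Q j) (yc j -` A \<inter> space (Q j)))"
proof -
  have [measurable]: "f j \<in> borel_measurable N" if "j \<in> J" for j
    using yc[OF that] by (rule distributed_borel_measurable)
  note A [measurable]
  have "emeasure P (y -` A \<inter> space P) = (\<integral>\<^sup>+x. (\<Sum>j\<in>J. w j * f j x) * indicator A x \<partial>N)"
    using distributed_emeasure[OF y A] .
  also have "\<dots> = (\<integral>\<^sup>+x. (\<Sum>j\<in>J. w j * (f j x * indicator A x)) \<partial>N)"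
    by (simp add: sum_distrib_right mult.assoc)
  also have "\<dots> = (\<Sum>j\<in>J. \<integral>\<^sup>+x. w j * (f j x * indicator A x) \<partial>N)"
    by (rule nn_integral_sum) measurable
  also have "\<dots> = (\<Sum>j\<in>J. w j * (\<integral>\<^sup>+x. f j x * indicator A x \<partial>N))"
    by (intro sum.cong refl nn_integral_cmult) measurable
  also have "\<dots> = (\<Sum>j\<in>J. w j * emeasure (Q j) (yc j -` A \<inter> space (Q j)))"
    by (intro sum.cong refl) (simp add: distributed_emeasure[OF yc A])
  finally show ?thesis .
qed

text \<open>
  The sign of the density is that of its normalising constant, the same at every point
  (\<open>sqrt\<close> is an odd function, so a negative determinant would give a negative constant). If the
  constant were negative, \<open>ennreal\<close> would truncate the density to zero everywhere, which
  contradicts total mass one.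
\<close>
lemma gaussian_density_nonneg:
  fixes y :: "'a \<Rightarrow> real ^ 'd"
  assumes "prob_space P" and g: "gaussian_distributed P y \<mu> S"
  shows "0 \<le> gaussian_density \<mu> S x"
proof (rule ccontr)
  interpret prob_space P by fact
  assume "\<not> 0 \<le> gaussian_density \<mu> S x"
  then have "sqrt ((2 * pi) ^ CARD('d) * det S) < 0"
    unfolding gaussian_density_def by (meson divide_nonneg_nonneg exp_ge_zero not_le)
  then have "gaussian_density \<mu> S z \<le> 0" for z
    unfolding gaussian_density_def by (intro divide_nonneg_nonpos) auto
  then have zero: "ennreal (gaussian_density \<mu> S z) = 0" for z
    by (rule ennreal_neg)
  have "emeasure P (y -` UNIV \<inter> space P) = 0"
    using distributed_emeasure[OF g[unfolded gaussian_distributed_def], of UNIV]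
    by (simp add: zero)
  then show False
    by (simp add: emeasure_space_1)
qed

lemma mixture_failure_risk:
  fixes y :: "'a \<Rightarrow> real ^ 'd" and yc :: "nat \<Rightarrow> 'b \<Rightarrow> real ^ 'd"
  assumes "prob_space P"
    and y: "gaussian_mixture_distributed P y M \<alpha> \<mu> S"
    and Q: "\<And>j. j \<in> {1..M} \<Longrightarrow> prob_space (Q j)"
    and yc: "\<And>j. j \<in> {1..M} \<Longrightarrow> gaussian_distributed (Q j) (yc j) (\<mu> j) (S j)"
    and \<alpha>: "\<And>j. j \<in> {1..M} \<Longrightarrow> 0 \<le> \<alpha> j"
    and sum_\<alpha>: "(\<Sum>j = 1..M. \<alpha> j) = 1"
  shows "failure_risk P y = (\<Sum>j = 1..M. \<alpha> j * failure_risk (Q j) (yc j))"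
proof -
  interpret prob_space P by fact
  let ?A = "{..0} :: (real ^ 'd) set"
  let ?p = "\<lambda>j. measure (Q j) (yc j -` ?A \<inter> space (Q j))"
  \<comment> \<open>\<open>ennreal\<close> is additive only on nonnegative terms.\<close>
  have split: "ennreal (\<Sum>j = 1..M. \<alpha> j * gaussian_density (\<mu> j) (S j) x)
      = (\<Sum>j = 1..M. ennreal (\<alpha> j) * ennreal (gaussian_density (\<mu> j) (S j) x))" for x
  proof -
    have nonneg: "0 \<le> gaussian_density (\<mu> j) (S j) x" if "j \<in> {1..M}" for j
      using gaussian_density_nonneg[OF Q[OF that] yc[OF that]] .
    have "ennreal (\<Sum>j = 1..M. \<alpha> j * gaussian_density (\<mu> j) (S j) x)
        = (\<Sum>j = 1..M. ennreal (\<alpha> j * gaussian_density (\<mu> j) (S j) x))"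
      by (rule sum_ennreal[symmetric]) (intro mult_nonneg_nonneg \<alpha> nonneg)
    also have "\<dots> = (\<Sum>j = 1..M. ennreal (\<alpha> j) * ennreal (gaussian_density (\<mu> j) (S j) x))"
      by (intro sum.cong refl ennreal_mult \<alpha> nonneg)
    finally show ?thesis .
  qed
  have A: "?A \<in> sets lborel"
    by simp
  have "ennreal (prob (y -` ?A \<inter> space P)) = emeasure P (y -` ?A \<inter> space P)"
    by (simp add: emeasure_eq_measure)
  also have "\<dots> = (\<Sum>j = 1..M. ennreal (\<alpha> j) * emeasure (Q j) (yc j -` ?A \<inter> space (Q j)))"
    by (rule mixture_emeasure[OF y[unfolded gaussian_mixture_distributed_def split]
        yc[unfolded gaussian_distributed_def] A])
  also have "\<dots> = (\<Sum>j = 1..M. ennreal (\<alpha> j * ?p j))"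
  proof (intro sum.cong refl)
    fix j assume j: "j \<in> {1..M}"
    interpret Qj: prob_space "Q j" using Q[OF j] .
    show "ennreal (\<alpha> j) * emeasure (Q j) (yc j -` ?A \<inter> space (Q j)) = ennreal (\<alpha> j * ?p j)"
      using \<alpha>[OF j] by (simp add: Qj.emeasure_eq_measure ennreal_mult)
  qed
  also have "\<dots> = ennreal (\<Sum>j = 1..M. \<alpha> j * ?p j)"
    by (intro sum_ennreal mult_nonneg_nonneg \<alpha> measure_nonneg)
  finally have "prob (y -` ?A \<inter> space P) = (\<Sum>j = 1..M. \<alpha> j * ?p j)"
    by (subst (asm) ennreal_inj) (auto intro!: sum_nonneg mult_nonneg_nonneg \<alpha>)
  then have "failure_risk P y = (\<Sum>j = 1..M. \<alpha> j) - (\<Sum>j = 1..M. \<alpha> j * ?p j)"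
    unfolding sum_\<alpha> by (simp add: failure_risk_def vimage_def Int_def conj_commute)
  also have "\<dots> = (\<Sum>j = 1..M. \<alpha> j * failure_risk (Q j) (yc j))"
    by (simp add: failure_risk_def vimage_def Int_def conj_commute right_diff_distrib
        sum_subtractf)
  finally show ?thesis .
qed

text \<open>
  Multiplying the recursion by \<open>\<alpha> (j + 1)\<close> turns it into
  \<open>\<alpha> (j + 1) * \<delta> (j + 1) = \<alpha> j * \<delta> j + \<alpha> (j + 1) * (\<beta> - \<beta>T (j + 1))\<close>, which telescopes.
\<close>
lemma weighted_slack_eq_accumulated_surplus:
  fixes \<alpha> \<beta>T \<beta>star \<delta> :: "nat \<Rightarrow> real"
  assumes nonzero: "\<And>j. j \<in> {1..M} \<Longrightarrow> \<alpha> j \<noteq> 0"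
    and start: "\<beta>star 1 = \<beta>"
    and slack: "\<And>j. j \<in> {1..M} \<Longrightarrow> \<delta> j = \<beta>star j - \<beta>T j"
    and recursion: "\<And>j. j \<in> {1..<M} \<Longrightarrow> \<beta>star (j + 1) = \<beta> + \<alpha> j / \<alpha> (j + 1) * \<delta> j"
    and "1 \<le> k" "k \<le> M"
  shows "\<alpha> k * \<delta> k = (\<Sum>j = 1..k. \<alpha> j * (\<beta> - \<beta>T j))"
  using \<open>1 \<le> k\<close> \<open>k \<le> M\<close>
proof (induction k rule: dec_induct)
  case base
  then show ?case
    using slack[of 1] start by simp
next
  case (step k)
  have "\<alpha> (Suc k) * \<delta> (Suc k) = \<alpha> k * \<delta> k + \<alpha> (Suc k) * (\<beta> - \<beta>T (Suc k))"
  proof -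
    have "\<alpha> (Suc k) * \<beta>star (Suc k) = \<alpha> (Suc k) * \<beta> + \<alpha> k * \<delta> k"
      using recursion[of k] nonzero[of "Suc k"] step.hyps step.prems by (simp add: field_simps)
    moreover have "\<delta> (Suc k) = \<beta>star (Suc k) - \<beta>T (Suc k)"
      using slack[of "Suc k"] step.prems by simp
    ultimately show ?thesis
      by (simp only: right_diff_distrib)
  qed
  then show ?case
    using step by simp
qed

theorem theorem1:
  fixes M :: nat
    and \<beta> :: real
    and P :: "'a measure" and y :: "'a \<Rightarrow> real ^ 'd"
    and Q :: "nat \<Rightarrow> 'b measure" and yc :: "nat \<Rightarrow> 'b \<Rightarrow> real ^ 'd"
    and \<alpha> :: "nat \<Rightarrow> real"
    and \<mu> :: "nat \<Rightarrow> real ^ 'd" and S :: "nat \<Rightarrow> real ^ 'd ^ 'd"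
    and \<beta>T \<beta>star \<delta> :: "nat \<Rightarrow> real"
  assumes "M \<ge> 1"
    and "0 < \<beta>" and "\<beta> < 1"
    and "\<forall>j\<in>{1..M}. \<alpha> j > 0"
    and "(\<Sum>j = 1..M. \<alpha> j) = 1"
    and "\<forall>j\<in>{1..M}. sym_pos_def (S j)"
    and "prob_space P"
    and "gaussian_mixture_distributed P y M \<alpha> \<mu> S"
    and "\<forall>j\<in>{1..M}. prob_space (Q j)"
    and "\<forall>j\<in>{1..M}. gaussian_distributed (Q j) (yc j) (\<mu> j) (S j)"
    and "\<forall>j\<in>{1..M}. \<beta>T j \<ge> failure_risk (Q j) (yc j)"
    and "\<beta>star 1 = \<beta>"
    and "\<forall>j\<in>{1..M}. \<delta> j = \<beta>star j - \<beta>T j"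
    and "\<forall>j\<in>{1..<M}. \<beta>star (j + 1) = \<beta> + \<alpha> j / \<alpha> (j + 1) * \<delta> j"
    and "\<forall>j\<in>{1..M}. \<beta>T j \<le> \<beta>star j"
  shows "failure_risk P y \<le> \<beta>"
proof -
  have "failure_risk P y = (\<Sum>j = 1..M. \<alpha> j * failure_risk (Q j) (yc j))"
    using assms by (intro mixture_failure_risk) (auto simp: less_imp_le)
  also have "\<dots> \<le> (\<Sum>j = 1..M. \<alpha> j * \<beta>T j)"
    using assms(4,11) by (intro sum_mono mult_left_mono) (auto simp: less_imp_le)
  also have "\<dots> \<le> (\<Sum>j = 1..M. \<alpha> j * \<beta>)"
  proof -
    have "\<alpha> M * \<delta> M = (\<Sum>j = 1..M. \<alpha> j * (\<beta> - \<beta>T j))"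
    proof (rule weighted_slack_eq_accumulated_surplus)
      show "\<alpha> j \<noteq> 0" if "j \<in> {1..M}" for j
        using assms(4) that by force
    qed (use assms(1,12-14) in auto)
    moreover have "0 \<le> \<alpha> M * \<delta> M"
      using assms(1,4,13,15) by (intro mult_nonneg_nonneg) (auto simp: less_imp_le)
    ultimately show ?thesis
      by (simp add: right_diff_distrib sum_subtractf)
  qed
  also have "\<dots> = \<beta>"
    using assms(5) by (simp flip: sum_distrib_right)
  finally show ?thesis .
qed

end
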